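(* Let $n,k,d\ge 1$ be integers, let $\chi$ be a Dirichlet character with conductor $d$, let $a,b$ be positive real numbers, let $\beta\in\mathbb{C}$, and let $x\in\mathbb{R}$. Then $$y_{n,\chi,\beta}(x:k,a,b)=d^{\,n-k}\sum_{j=0}^{d-1}\chi(j)\left(\frac{\beta}{a}\right)^{bj}y_{n,\beta^{d}}\left(\frac{x+j}{d}:k,a^{d},b\right).$$
   Context: For an integer $k\ge 1$, reals $a,b>0$, $\beta\in\mathbb{C}$ and $x\in\mathbb{R}$, the polynomials $y_{n,\beta}(x:k,a,b)$ ($n\ge 0$) are defined by the power series expansion at $t=0$ $$\frac{2\left(\frac{t}{2}\right)^{k}}{\beta^{b}e^{t}-a^{b}}\,e^{xt}=\sum_{n=0}^{\infty}y_{n,\beta}(x:k,a,b)\frac{t^{n}}{n!}.$$ For a Dirichlet character $\chi$ with conductor $d$ (regarded as a $d$-periodic function on $\mathbb{Z}$), the generalized polynomials $y_{n,\chi,\beta}(x:k,a,b)$ are defined by the power series expansion at $t=0$ $$2\left(\frac{t}{2}\right)^{k}\sum_{j=0}^{d-1}\frac{\chi(j)\left(\frac{\beta}{a}\right)^{bj}e^{(x+j)t}}{\beta^{bd}e^{dt}-a^{bd}}=\sum_{n=0}^{\infty}y_{n,\chi,\beta}(x:k,a,b)\frac{t^{n}}{n!}.$$ Complex powers are taken with respect to one fixed choice of $\log\beta$: $\beta^{s}=\exp(s\log\beta)$ and $(\beta/a)^{s}=\beta^s/a^s$ for real $s\ge 0$, and for the parameter $\beta^d$ one uses $(\beta^d)^b=\beta^{bd}$;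 if $\beta=0$ then $0^s=0$ for $s>0$ and $0^0=1$. *)

theory Defs
  imports "HOL-Complex_Analysis.Complex_Analysis" "HOL-Number_Theory.Cong"
begin

text \<open>
  The coefficients \<open>c\<^sub>n\<close> of the expansion \<open>f t = (\<Sum>n. c\<^sub>n * t ^ n / n!)\<close> at \<open>t = 0\<close>.
  The expansion is taken on a punctured neighbourhood of 0, because the generating functions
  below can have a removable singularity at 0, where the totalised quotient \<open>0 / 0 = 0\<close>
  yields the wrong value.
\<close>

definition egf_coeff :: "(complex \<Rightarrow> complex) \<Rightarrow> nat \<Rightarrow> complex" where
  "egf_coeff f n = fact n * fls_nth (laurent_expansion f 0) (int n)"

text \<open>
  The power \<open>\<beta>\<^sup>s\<close> with respect to the choice \<open>l\<close> of \<open>log \<beta>\<close>; for \<open>\<beta> \<noteq> 0\<close> it is used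
  with \<open>exp l = \<beta>\<close>, and for \<open>\<beta> = 0\<close> the number \<open>l\<close> is irrelevant.
\<close>

definition cpower :: "complex \<Rightarrow> complex \<Rightarrow> real \<Rightarrow> complex" where
  "cpower l \<beta> s = (if \<beta> = 0 then (if s = 0 then 1 else 0) else exp (of_real s * l))"

text \<open>\<open>y_poly n l \<beta> x k a b\<close> is \<open>y\<^bsub>n,\<beta>\<^esub>(x : k, a, b)\<close>, where \<open>l\<close> is the choice of \<open>log \<beta>\<close>.\<close>

definition y_gf :: "complex \<Rightarrow> complex \<Rightarrow> real \<Rightarrow> nat \<Rightarrow> real \<Rightarrow> real \<Rightarrow> complex \<Rightarrow> complex" where
  "y_gf l \<beta> x k a b t =
     2 * (t / 2) ^ k / (cpower l \<beta> b * exp t - of_real (a powr b)) * exp (of_real x * t)"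

definition y_poly :: "nat \<Rightarrow> complex \<Rightarrow> complex \<Rightarrow> real \<Rightarrow> nat \<Rightarrow> real \<Rightarrow> real \<Rightarrow> complex" where
  "y_poly n l \<beta> x k a b = egf_coeff (y_gf l \<beta> x k a b) n"

definition dirichlet_character :: "nat \<Rightarrow> (int \<Rightarrow> complex) \<Rightarrow> bool" where
  "dirichlet_character N chi \<longleftrightarrow>
     N > 0 \<and>
     (\<forall>m. chi (m + int N) = chi m) \<and>
     (\<forall>m n. chi (m * n) = chi m * chi n) \<and>
     (\<forall>m. chi m \<noteq> 0 \<longleftrightarrow> coprime m (int N))"

definition conductor :: "nat \<Rightarrow> (int \<Rightarrow> complex) \<Rightarrow> nat" where
  "conductor N chi =
     (LEAST q. q > 0 \<and> q dvd N \<and>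
        (\<forall>m n. coprime m (int N) \<and> coprime n (int N) \<and> [m = n] (mod int q) \<longrightarrow> chi m = chi n))"

definition y_chi_gf ::
    "nat \<Rightarrow> (int \<Rightarrow> complex) \<Rightarrow> complex \<Rightarrow> complex \<Rightarrow> real \<Rightarrow> nat \<Rightarrow> real \<Rightarrow> real \<Rightarrow> complex \<Rightarrow> complex"
where
  "y_chi_gf d chi l \<beta> x k a b t =
     2 * (t / 2) ^ k *
       (\<Sum>j<d. chi (int j) * (cpower l \<beta> (b * real j) / of_real (a powr (b * real j))) *
          exp (of_real (x + real j) * t) /
          (cpower l \<beta> (b * real d) * exp (of_nat d * t) - of_real (a powr (b * real d))))"

definition y_chi_poly ::
    "nat \<Rightarrow> nat \<Rightarrow> (int \<Rightarrow> complex) \<Rightarrow> complex \<Rightarrow> complex \<Rightarrow> real \<Rightarrow> nat \<Rightarrow> real \<Rightarrow> real \<Rightarrow> complex" where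
  "y_chi_poly n d chi l \<beta> x k a b = egf_coeff (y_chi_gf d chi l \<beta> x k a b) n"

text \<open>
  For \<open>k \<ge> 1\<close> and \<open>a > 0\<close> the singularity at 0 is removable, and the numbers defined above
  are the coefficients of genuine power series expansions.
\<close>

lemma egf_coeff_sums:
  assumes f: "f has_laurent_expansion F" and deg: "F = 0 \<or> fls_subdegree F \<ge> 0"
  shows "\<forall>\<^sub>F t in at 0. (\<lambda>n. egf_coeff f n * t ^ n / fact n) sums f t"
proof -
  define G where "G = fls_regpart F"
  have F: "F = fps_to_fls G"
    using deg unfolding G_def by (auto simp: fls_eq_iff)
  have rad: "fps_conv_radius G > 0"
    and ev: "\<forall>\<^sub>F t in at 0. eval_fls F t = f t"
    using f by (auto simp: has_laurent_expansion_def F)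
  have "\<forall>\<^sub>F t in at 0. t \<in> eball 0 (fps_conv_radius G) - {0}"
    using rad by (intro eventually_at_in_open) (auto simp: zero_ereal_def)
  with ev show ?thesis
  proof eventually_elim
    case (elim t)
    hence "(\<lambda>n. fps_nth G n * t ^ n) sums eval_fps G t"
      by (intro sums_eval_fps) auto
    moreover have "eval_fps G t = f t"
      using elim by (simp add: F eval_fps_to_fls)
    moreover have "egf_coeff f n / fact n = fps_nth G n" for n
      using laurent_expansion_0_eqI[OF f] by (simp add: egf_coeff_def F)
    hence "egf_coeff f n * t ^ n / fact n = fps_nth G n * t ^ n" for n
      by (metis times_divide_eq_left)
    ultimately show ?case
      by simp
  qed
qed

lemma egf_coeff_quotient_sums:
  fixes A B c :: complex
  assumes g: "g has_fps_expansion G" and k: "k \<ge> 1" and B: "B \<noteq> 0" and c: "c \<noteq> 0"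
    and f: "f = (\<lambda>t. t ^ k * g t / (A * exp (c * t) - B))"
  shows "\<forall>\<^sub>F t in at 0. (\<lambda>n. egf_coeff f n * t ^ n / fact n) sums f t"
proof -
  define Q where "Q = fps_const A * fps_exp c - fps_const B"
  define P where "P = fps_X ^ k * G"
  have "(\<lambda>t. A * exp (c * t) - B) has_fps_expansion Q"
    unfolding Q_def by (intro fps_expansion_intros)
  moreover have "(\<lambda>t. t ^ k * g t) has_fps_expansion P"
    unfolding P_def by (intro fps_expansion_intros g)
  ultimately have L: "f has_laurent_expansion (fps_to_fls P / fps_to_fls Q)"
    unfolding f by (intro has_laurent_expansion_divide has_laurent_expansion_fps)
  have Q0: "fps_nth Q 0 = A - B" and Q1: "fps_nth Q 1 = A * c"
    by (simp_all add: Q_def)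
  have "fps_nth Q 0 \<noteq> 0 \<or> fps_nth Q 1 \<noteq> 0"
    using B c Q0 Q1 by auto
  hence Q: "Q \<noteq> 0" "subdegree Q \<le> 1"
    by (auto intro: subdegree_leI order.trans[OF subdegree_leI])
  have "fps_to_fls P / fps_to_fls Q = 0 \<or> fls_subdegree (fps_to_fls P / fps_to_fls Q) \<ge> 0"
  proof (cases "P = 0")
    case False
    hence "subdegree P \<ge> 1"
      using k by (auto simp: P_def)
    with Q False show ?thesis
      by (simp add: fls_divide_subdegree fls_subdegree_fls_to_fps)
  qed auto
  with L show ?thesis
    by (rule egf_coeff_sums)
qed

lemma y_poly_sums:
  assumes "k \<ge> 1" "a > 0"
  shows "\<forall>\<^sub>F t in at 0. (\<lambda>n. y_poly n l \<beta> x k a b * t ^ n / fact n) sums y_gf l \<beta> x k a b t"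
  unfolding y_poly_def
proof (rule egf_coeff_quotient_sums)
  show "(\<lambda>t. (2 / 2 ^ k) * exp (complex_of_real x * t)) has_fps_expansion
          fps_const ((2 / 2 ^ k)) * fps_exp (complex_of_real x)"
    by (intro fps_expansion_intros)
  show "y_gf l \<beta> x k a b = (\<lambda>t. t ^ k * ((2 / 2 ^ k) * exp (complex_of_real x * t)) /
          (cpower l \<beta> b * exp (1 * t) - of_real (a powr b)))"
    by (rule ext) (simp add: y_gf_def power_divide)
qed (use assms in auto)

lemma y_chi_poly_sums:
  assumes "k \<ge> 1" "a > 0" "d \<ge> 1"
  shows "\<forall>\<^sub>F t in at 0.
           (\<lambda>n. y_chi_poly n d chi l \<beta> x k a b * t ^ n / fact n) sums y_chi_gf d chi l \<beta> x k a b t"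
  unfolding y_chi_poly_def
proof (rule egf_coeff_quotient_sums)
  let ?C = "\<lambda>j. chi (int j) * (cpower l \<beta> (b * real j) / of_real (a powr (b * real j)))"
  show "(\<lambda>t. (2 / 2 ^ k) * (\<Sum>j<d. ?C j * exp (of_real (x + real j) * t))) has_fps_expansion
          fps_const ((2 / 2 ^ k)) *
            (\<Sum>j<d. fps_const (?C j) * fps_exp (of_real (x + real j)))"
    by (intro fps_expansion_intros)
  show "y_chi_gf d chi l \<beta> x k a b =
          (\<lambda>t. t ^ k * ((2 / 2 ^ k) * (\<Sum>j<d. ?C j * exp (of_real (x + real j) * t))) /
            (cpower l \<beta> (b * real d) * exp (of_nat d * t) - of_real (a powr (b * real d))))"
    unfolding y_chi_gf_def power_divide sum_divide_distrib [symmetric] by (rule ext) simp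
qed (use assms in auto)

end

theory Submission
  imports Defs
begin

text \<open>
  Since \<open>(\<beta>\<^sup>d)\<^sup>b = \<beta>\<^bsup>bd\<^esup>\<close> and \<open>(a\<^sup>d)\<^sup>b = a\<^bsup>bd\<^esup>\<close>, the \<open>j\<close>-th summand of the generating function
  of the generalized polynomials at \<open>t\<close> is \<open>d\<^bsup>-k\<^esup> \<chi>(j) (\<beta>/a)\<^bsup>bj\<^esup>\<close> times the generating function of
  \<open>y\<^bsub>n,\<beta>^d\<^esub>((x + j)/d : k, a\<^sup>d, b)\<close> at \<open>d t\<close>. The theorem compares coefficients of \<open>t\<^sup>n\<close>.
\<close>

text \<open>Convergence at a single nonzero point already forces a positive radius of convergence.
  The power series is then a Laurent expansion of \<open>f\<close> at 0, and that expansion is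
  unique.\<close>

lemma egf_coeff_eqI:
  assumes "\<forall>\<^sub>F t in at 0. (\<lambda>n. c n * t ^ n / fact n) sums f t"
  shows "egf_coeff f n = c n"
proof -
  define G where "G = Abs_fps (\<lambda>n. c n / fact n)"
  have sums: "\<forall>\<^sub>F t in at 0. (\<lambda>n. fps_nth G n * t ^ n) sums f t"
    using assms by (simp add: G_def)
  have "\<forall>\<^sub>F t in at 0. (\<lambda>n. fps_nth G n * t ^ n) sums f t \<and> t \<noteq> (0::complex)"
    using sums by (auto intro: eventually_conj simp: eventually_at_filter)
  then obtain t where t: "summable (\<lambda>n. fps_nth G n * t ^ n)" "t \<noteq> 0"
    using eventually_happens'[OF at_neq_bot] sums_summable by (metis (mono_tags, lifting))
  have "0 < ereal (norm t)"
    using t by simp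
  also have "\<dots> \<le> fps_conv_radius G"
    unfolding fps_conv_radius_def using t by (intro conv_radius_geI)
  finally have rad: "fps_conv_radius G > 0" .
  hence "\<forall>\<^sub>F t in at 0. t \<in> eball 0 (fps_conv_radius G) - {0}"
    by (intro eventually_at_in_open) (auto simp: zero_ereal_def)
  with sums have "\<forall>\<^sub>F t in at 0. eval_fls (fps_to_fls G) t = f t"
    by eventually_elim (simp add: eval_fps_to_fls eval_fps_def sums_iff)
  with rad have "f has_laurent_expansion fps_to_fls G"
    by (simp add: has_laurent_expansion_def)
  hence "laurent_expansion f 0 = fps_to_fls G"
    by (rule laurent_expansion_0_eqI)
  thus ?thesis
    by (simp add: egf_coeff_def G_def)
qed

text \<open>Taking \<open>of_nat d * l\<close> as the logarithm of \<open>\<beta> ^ d\<close>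
  realises the convention for its powers. For \<open>\<beta> = 0\<close> both sides vanish, because
  \<open>b\<close> and \<open>b * real d\<close> are positive.\<close>

lemma cpower_power:
  assumes "d \<ge> 1" "b > 0"
  shows "cpower (of_nat d * l) (\<beta> ^ d) b = cpower l \<beta> (b * real d)"
  using assms by (simp add: cpower_def mult_ac)

text \<open>The factor \<open>of_nat d ^ k\<close> comes from \<open>(t / 2) ^ k\<close> alone: in
  the exponential, the division of \<open>x\<close> by \<open>d\<close> cancels the scaling of
  \<open>t\<close>.\<close>

lemma y_gf_scale:
  fixes a b x :: real
  assumes "d \<ge> 1" "a > 0" "b > 0"
  shows "y_gf (of_nat d * l) (\<beta> ^ d) (x / real d) k (a ^ d) b (of_nat d * t) =
           of_nat d ^ k * (2 * (t / 2) ^ k * exp (of_real x * t) /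
             (cpower l \<beta> (b * real d) * exp (of_nat d * t) - of_real (a powr (b * real d))))"
proof -
  have "(a ^ d) powr b = a powr (b * real d)"
    using assms by (simp add: powr_realpow[symmetric] powr_powr mult.commute)
  moreover have "(of_nat d * t / 2) ^ k = of_nat d ^ k * (t / 2) ^ k"
    by (simp add: power_mult_distrib power_divide)
  moreover have "complex_of_real (x / real d) * (of_nat d * t) = of_real x * t"
    using assms by simp
  ultimately show ?thesis
    using assms by (simp add: y_gf_def cpower_power)
qed

lemma y_chi_gf_eq_sum_y_gf:
  fixes a b x :: real
  assumes "d \<ge> 1" "a > 0" "b > 0"
  shows "y_chi_gf d chi l \<beta> x k a b t =
           (\<Sum>j<d. chi (int j) * (cpower l \<beta> (b * real j) / of_real (a powr (b * real j))) *
              y_gf (of_nat d * l) (\<beta> ^ d) ((x + real j) / real d) k (a ^ d) b (of_nat d * t))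
             / of_nat d ^ k"
  unfolding y_gf_scale[OF assms] y_chi_gf_def sum_divide_distrib sum_distrib_left
  using assms by (intro sum.cong) auto

theorem theorem8:
  fixes n k d :: nat and chi :: "int \<Rightarrow> complex" and a b x :: real and \<beta> l :: complex
  assumes "n \<ge> 1" and "k \<ge> 1" and "d \<ge> 1"
    and "dirichlet_character d chi" and "conductor d chi = d"
    and "a > 0" and "b > 0"
    and "\<beta> \<noteq> 0 \<longrightarrow> exp l = \<beta>"
  shows "y_chi_poly n d chi l \<beta> x k a b =
           of_nat d powi (int n - int k) *
             (\<Sum>j<d. chi (int j) * (cpower l \<beta> (b * real j) / of_real (a powr (b * real j))) *
                y_poly n (of_nat d * l) (\<beta> ^ d) ((x + real j) / real d) k (a ^ d) b)"
proof -
  let ?C = "\<lambda>j. chi (int j) * (cpower l \<beta> (b * real j) / of_real (a powr (b * real j)))"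
  let ?y = "\<lambda>m j. y_poly m (of_nat d * l) (\<beta> ^ d) ((x + real j) / real d) k (a ^ d) b"
  let ?g = "\<lambda>j. y_gf (of_nat d * l) (\<beta> ^ d) ((x + real j) / real d) k (a ^ d) b"
  let ?D = "of_nat d :: complex"
  \<comment> \<open>As \<open>d\<close> is nonzero, the scaling keeps nonzero points nonzero, so
    expansions valid only off 0 can be composed with it.\<close>
  have lim: "filterlim (\<lambda>t. ?D * t) (at 0) (at 0)"
    using \<open>d \<ge> 1\<close> by (auto simp: filterlim_at eventually_at_filter intro!: tendsto_eq_intros)
  \<comment> \<open>Finitely many \<open>j\<close> share one punctured neighbourhood, which permits
    adding the series termwise.\<close>
  have "\<forall>\<^sub>F t in at 0. \<forall>j\<in>{..<d}. (\<lambda>m. ?y m j * (?D * t) ^ m / fact m) sums ?g j (?D * t)"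
    using assms
    by (intro eventually_ball_finite ballI eventually_compose_filterlim[OF y_poly_sums lim]) auto
  hence "\<forall>\<^sub>F t in at 0. (\<lambda>m. (?D powi (int m - int k) * (\<Sum>j<d. ?C j * ?y m j)) * t ^ m / fact m)
           sums y_chi_gf d chi l \<beta> x k a b t"
  proof eventually_elim
    case (elim t)
    hence "(\<lambda>m. (\<Sum>j<d. ?C j * (?y m j * (?D * t) ^ m / fact m)) / ?D ^ k)
             sums ((\<Sum>j<d. ?C j * ?g j (?D * t)) / ?D ^ k)"
      by (intro sums_divide sums_sum sums_mult) auto
    moreover have "(\<Sum>j<d. ?C j * (?y m j * (?D * t) ^ m / fact m)) / ?D ^ k =
        (?D powi (int m - int k) * (\<Sum>j<d. ?C j * ?y m j)) * t ^ m / fact m" for m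
    proof -
      have "(\<Sum>j<d. ?C j * (?y m j * (?D * t) ^ m / fact m)) =
              (\<Sum>j<d. ?C j * ?y m j) * ((?D * t) ^ m / fact m)"
        by (simp add: sum_distrib_right sum_divide_distrib mult.assoc)
      \<comment> \<open>The exponent is an integer, since \<open>m < k\<close> can occur; splitting
        it uses that \<open>d\<close> is nonzero.\<close>
      moreover have "?D powi (int m - int k) = ?D ^ m / ?D ^ k"
        using \<open>d \<ge> 1\<close> by (simp add: power_int_diff)
      ultimately show ?thesis
        by (simp only: power_mult_distrib) (simp add: mult_ac)
    qed
    ultimately show ?case
      using assms by (simp only: y_chi_gf_eq_sum_y_gf)
  qed
  thus ?thesis
    unfolding y_chi_poly_def by (rule egf_coeff_eqI)
qed

end
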